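(* (i) For every integer $k\ge 2$ there exists a graph $G$ with $\mathrm{sgc}(G) = k$ and $\mathrm{sg}(G) = k+1$. (ii) For every integer $n\ge 3$ there exists a graph $G$ of order $n$ with $\mathrm{sgc}(G) = \lfloor n/3 \rfloor$ and $\mathrm{sg}(G) = n - \lfloor n/3 \rfloor$. (iii) For all integers $k\ge 1$, $d\ge 2$, $s\ge 0$, there exists a graph $G$ with $\mathrm{sg}(G)=k+s$, $\mathrm{diam}(G)=d$, and $$\mathrm{sgc}(G) = k = \left\lceil \mathrm{sg}(G) - \frac{1+\sqrt{(2\,\mathrm{sg}(G)-1)^2-\frac{8[n(G)-\mathrm{sg}(G)]}{\mathrm{diam}(G)-1}}}{2} \right\rceil.$$
   Context: Graphs are finite, simple and connected. For a graph $G$ and $S\subseteq V(G)$, one fixes for each unordered pair $\{x,y\}$ of distinct vertices of $S$ a single shortest $x,y$-path $\widetilde g(x,y)$; $S$ is a strong geodetic set if for some such choice the union of the vertex sets of the chosen paths equals $V(G)$. $\mathrm{sg}(G)$ is the minimum size of a strong geodetic set; a minimum one is an sg-set. For a strong geodetic set $S$, a set $X\subseteq S$ is a strong geodetic core for $S$ if there exists a choice of fixed shortest paths $\widetilde g(x,y)$ for pairs of $S$ such that $\bigcup_{(u,v)\in X\times S} V(\widetilde g(u,v)) = V(G)$. $\mathrm{sgc}(S)$ is the minimum size of a strong geodetic core for $S$, and $\mathrm{sgc}(G)=\min\{\mathrm{sgc}(S): S \text{ an sg-set of } G\}$. $n(G)$ is the order and $\mathrm{diam}(G)$ the diameter of 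$G$.
   Formalization: Part (iii) is stated for s ≥ 1 instead of s ≥ 0: for s = 0 it would require sgc(G) = sg(G) with diam(G) ≥ 2, which is impossible because deleting one vertex from an sg-set leaves a strong geodetic core, so sgc(G) < sg(G). *)

theory Defs
  imports Complex_Main "Graph_Theory.Graph_Theory"
begin

text \<open>
  A finite simple graph is a \<^locale>\<open>pair_graph\<close>: a finite, symmetric, loop-free digraph
  whose arcs are pairs of vertices, so that every edge is represented by its two orientations.
  The constant \<^const>\<open>Digraph_Component.connected\<close> includes that there is a vertex.
\<close>

definition conn_graph :: "'a pair_pre_digraph \<Rightarrow> bool" where
  "conn_graph G \<longleftrightarrow> pair_graph G \<and> Digraph_Component.connected (with_proj G)"

abbreviation order :: "'a pair_pre_digraph \<Rightarrow> nat" where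
  "order G \<equiv> card (pverts G)"

definition path_between :: "'a pair_pre_digraph \<Rightarrow> 'a \<Rightarrow> 'a \<Rightarrow> 'a vwalk \<Rightarrow> bool" where
  "path_between G x y p \<longleftrightarrow> vpath p (with_proj G) \<and> hd p = x \<and> last p = y"

definition shortest_path :: "'a pair_pre_digraph \<Rightarrow> 'a \<Rightarrow> 'a \<Rightarrow> 'a vwalk \<Rightarrow> bool" where
  "shortest_path G x y p \<longleftrightarrow> path_between G x y p \<and>
     (\<forall>q. path_between G x y q \<longrightarrow> vwalk_length p \<le> vwalk_length q)"

definition distance :: "'a pair_pre_digraph \<Rightarrow> 'a \<Rightarrow> 'a \<Rightarrow> nat" where
  "distance G x y = (LEAST l. \<exists>p. path_between G x y p \<and> vwalk_length p = l)"

definition diam :: "'a pair_pre_digraph \<Rightarrow> nat" where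
  "diam G = Max {distance G x y | x y. x \<in> pverts G \<and> y \<in> pverts G}"

text \<open>
  A choice of one shortest path per unordered pair is a function on sets \<open>{x, y}\<close>; as the pair
  is unordered, the list of vertices may be traversed from either end.  The case \<open>x = y\<close> is
  included because pairs \<open>(u, u)\<close> occur in the product of a core with its strong geodetic set.
  There the choice is forced to be the trivial path \<open>[x]\<close>.  As soon as \<open>S\<close> has two elements this
  contributes nothing to the unions below; otherwise it only makes the vertex of the one-vertex
  graph a strong geodetic set.
\<close>

definition path_choice :: "'a pair_pre_digraph \<Rightarrow> 'a set \<Rightarrow> ('a set \<Rightarrow> 'a vwalk) \<Rightarrow> bool" where
  "path_choice G S g \<longleftrightarrow>
     (\<forall>x\<in>S. \<forall>y\<in>S. shortest_path G x y (g {x, y}) \<or> shortest_path G y x (g {x, y}))"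

definition strong_geodetic_set :: "'a pair_pre_digraph \<Rightarrow> 'a set \<Rightarrow> bool" where
  "strong_geodetic_set G S \<longleftrightarrow> S \<subseteq> pverts G \<and>
     (\<exists>g. path_choice G S g \<and> (\<Union>(x, y)\<in>S \<times> S. set (g {x, y})) = pverts G)"

definition sg :: "'a pair_pre_digraph \<Rightarrow> nat" where
  "sg G = (LEAST m. \<exists>S. strong_geodetic_set G S \<and> card S = m)"

definition sg_set :: "'a pair_pre_digraph \<Rightarrow> 'a set \<Rightarrow> bool" where
  "sg_set G S \<longleftrightarrow> strong_geodetic_set G S \<and> card S = sg G"

definition strong_geodetic_core :: "'a pair_pre_digraph \<Rightarrow> 'a set \<Rightarrow> 'a set \<Rightarrow> bool" where
  "strong_geodetic_core G S X \<longleftrightarrow> X \<subseteq> S \<and>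
     (\<exists>g. path_choice G S g \<and> (\<Union>(u, v)\<in>X \<times> S. set (g {u, v})) = pverts G)"

definition sgc_of :: "'a pair_pre_digraph \<Rightarrow> 'a set \<Rightarrow> nat" where
  "sgc_of G S = (LEAST m. \<exists>X. strong_geodetic_core G S X \<and> card X = m)"

definition sgc :: "'a pair_pre_digraph \<Rightarrow> nat" where
  "sgc G = (LEAST m. \<exists>S. sg_set G S \<and> sgc_of G S = m)"


text \<open>
  Deleting one vertex from a strong geodetic set with at least two elements leaves a core, since
  every pair still meets the remaining set.  Hence \<open>sgc G < sg G\<close> whenever \<open>G\<close> has an edge, and
  \<open>sg G = k + s\<close>, \<open>sgc G = k\<close>, \<open>diam G \<ge> 2\<close> are jointly impossible for \<open>s = 0\<close>.
\<close>

lemma shortest_path_exists: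
  assumes G: "conn_graph G" and x: "x \<in> pverts G" and y: "y \<in> pverts G"
  shows "\<exists>p. shortest_path G x y p"
proof -
  interpret pair_graph G using G by (simp add: conn_graph_def)
  have "strongly_connected (with_proj G)"
    using G symmetric_connected_imp_strongly_connected sym_arcs
    by (simp add: conn_graph_def)
  then have "x \<rightarrow>\<^sup>*\<^bsub>with_proj G\<^esub> y" using x y by (auto simp: strongly_connected_def)
  then obtain q where "vpath q (with_proj G)" "hd q = x" "last q = y"
    using reachable_vpath_conv by blast
  then have "path_between G x y q" by (simp add: path_between_def)
  from ex_has_least_nat[of "path_between G x y", OF this, of vwalk_length]
  show ?thesis unfolding shortest_path_def .
qed

lemma shortest_path_ends:
  assumes "shortest_path G x y p"
  shows "x \<in> set p" "y \<in> set p" "set p \<subseteq> pverts G"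
  using assms unfolding shortest_path_def path_between_def vpath_def vwalk_def by auto

lemma path_choice_exists:
  assumes "conn_graph G" "S \<subseteq> pverts G"
  shows "\<exists>g. path_choice G S g"
proof -
  define g where "g A = (SOME p. \<exists>x y. A = {x, y} \<and> shortest_path G x y p)" for A
  have "shortest_path G x y (g {x, y}) \<or> shortest_path G y x (g {x, y})"
    if xy: "x \<in> S" "y \<in> S" for x y
  proof -
    have "x \<in> pverts G" "y \<in> pverts G" using xy assms(2) by auto
    from shortest_path_exists[OF assms(1) this]
    obtain p where p: "shortest_path G x y p" by (rule exE)
    have "\<exists>p x' y'. {x, y} = {x', y'} \<and> shortest_path G x' y' p"
      by (rule exI[of _ p], rule exI[of _ x], rule exI[of _ y]) (simp add: p)
    then have "\<exists>x' y'. {x, y} = {x', y'} \<and> shortest_path G x' y' (g {x, y})"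
      unfolding g_def by (rule someI_ex)
    then obtain x' y' where e: "{x, y} = {x', y'}" and p': "shortest_path G x' y' (g {x, y})"
      by (elim exE conjE)
    from e have "x = x' \<and> y = y' \<or> x = y' \<and> y = x'" by (simp only: doubleton_eq_iff)
    then show ?thesis using p' by (elim disjE conjE) simp_all
  qed
  then show ?thesis unfolding path_choice_def by blast
qed

lemma path_choiceD:
  assumes "path_choice G S g" "x \<in> S" "y \<in> S"
  shows "x \<in> set (g {x, y})" "y \<in> set (g {x, y})" "set (g {x, y}) \<subseteq> pverts G"
proof -
  have "shortest_path G x y (g {x, y}) \<or> shortest_path G y x (g {x, y})"
    using assms unfolding path_choice_def by blast
  then show "x \<in> set (g {x, y})" "y \<in> set (g {x, y})" "set (g {x, y}) \<subseteq> pverts G"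
    using shortest_path_ends[of G x y "g {x, y}"] shortest_path_ends[of G y x "g {x, y}"]
    by argo+
qed

lemma strong_geodetic_set_pverts:
  assumes "conn_graph G"
  shows "strong_geodetic_set G (pverts G)"
proof -
  obtain g where g: "path_choice G (pverts G) g" using path_choice_exists assms by blast
  have "(\<Union>(x, y)\<in>pverts G \<times> pverts G. set (g {x, y})) = pverts G"
    (is "?U = _")
  proof
    show "?U \<subseteq> pverts G" using path_choiceD(3)[OF g] by blast
    show "pverts G \<subseteq> ?U" using path_choiceD(1)[OF g] by blast
  qed
  then show ?thesis using g unfolding strong_geodetic_set_def by blast
qed

lemma sg_set_exists:
  assumes "conn_graph G"
  shows "\<exists>S. sg_set G S"
  unfolding sg_set_def sg_def
  by (rule LeastI_ex) (use strong_geodetic_set_pverts[OF assms] in blast)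

lemma strong_geodetic_core_remove:
  assumes S: "strong_geodetic_set G S" and ab: "a \<in> S" "b \<in> S" "a \<noteq> b"
  shows "strong_geodetic_core G S (S - {a})"
proof -
  obtain g where g: "path_choice G S g" "(\<Union>(x, y)\<in>S \<times> S. set (g {x, y})) = pverts G"
    using S unfolding strong_geodetic_set_def by blast
  have aa: "set (g {a, a}) \<subseteq> {a}"
  proof -
    have "shortest_path G a a (g {a, a})" using g(1) ab unfolding path_choice_def by blast
    then have "distinct (g {a, a})" "hd (g {a, a}) = a" "last (g {a, a}) = a"
      unfolding shortest_path_def path_between_def vpath_def by auto
    then show ?thesis by (cases "g {a, a}") (auto split: if_splits)
  qed
  have cov: "v \<in> (\<Union>(x, y)\<in>(S - {a}) \<times> S. set (g {x, y}))" if "v \<in> pverts G" for v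
  proof -
    have "v \<in> (\<Union>(x, y)\<in>S \<times> S. set (g {x, y}))" using that g(2) by simp
    then obtain x y where xy: "x \<in> S" "y \<in> S" "v \<in> set (g {x, y})" by (elim UN_E) auto
    consider "x \<noteq> a" | "y \<noteq> a" | "x = a" "y = a" by blast
    then show ?thesis
    proof cases
      case 1 then show ?thesis using xy by blast
    next
      case 2
      have "v \<in> set (g {y, x})" using xy(3) by (simp only: insert_commute)
      then show ?thesis using 2 xy(1,2) by blast
    next
      case 3
      then have "v \<in> set (g {b, a})" using aa xy path_choiceD(2)[OF g(1) ab(2,1)] by auto
      then show ?thesis using ab by blast
    qed
  qed
  have "(\<Union>(x, y)\<in>(S - {a}) \<times> S. set (g {x, y})) = pverts G"
    (is "?U = _")
  proof
    show "?U \<subseteq> pverts G" using path_choiceD(3)[OF g(1)] by blast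
    show "pverts G \<subseteq> ?U" using cov by blast
  qed
  then show ?thesis unfolding strong_geodetic_core_def using g(1) by blast
qed

lemma sgc_less_sg:
  assumes G: "conn_graph G" and n: "order G \<ge> 2"
  shows "sgc G < sg G"
proof -
  obtain S where S: "sg_set G S" using sg_set_exists G by blast
  then have sgs: "strong_geodetic_set G S" by (simp add: sg_set_def)
  have "finite (pverts G)"
    using G by (simp add: conn_graph_def pair_graph_def pair_digraph_def
        pair_fin_digraph.pair_finite_verts)
  then have fin: "finite S" using sgs finite_subset by (auto simp: strong_geodetic_set_def)
  obtain g where g: "path_choice G S g" "(\<Union>(x, y)\<in>S \<times> S. set (g {x, y})) = pverts G"
    using sgs unfolding strong_geodetic_set_def by blast
  have "S \<noteq> {}" using g(2) n by auto
  moreover have "S \<noteq> {a}" for a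
  proof
    assume S: "S = {a}"
    then have "shortest_path G a a (g {a, a})" using g(1) unfolding path_choice_def by blast
    then have "distinct (g {a, a})" "hd (g {a, a}) = a" "last (g {a, a}) = a"
      unfolding shortest_path_def path_between_def vpath_def by auto
    then have "set (g {a, a}) \<subseteq> {a}" by (cases "g {a, a}") (auto split: if_splits)
    then have "pverts G \<subseteq> {a}" using g(2) S by auto
    then show False using n card_mono[of "{a}" "pverts G"] by simp
  qed
  ultimately obtain a b where ab: "a \<in> S" "b \<in> S" "a \<noteq> b" by blast
  have "sgc_of G S \<le> card (S - {a})"
    unfolding sgc_of_def
    by (rule Least_le) (use strong_geodetic_core_remove[OF sgs ab] in blast)
  also have "\<dots> < card S" using fin ab(1) by (rule card_Diff1_less)
  finally have "sgc_of G S < sg G" using S by (simp add: sg_set_def)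
  moreover have "sgc G \<le> sgc_of G S"
    unfolding sgc_def by (rule Least_le) (use S in blast)
  ultimately show ?thesis by simp
qed

lemma sgc_less_sg_diam:
  assumes G: "conn_graph G" and d: "diam G \<ge> 1"
  shows "sgc G < sg G"
proof (cases "order G \<ge> 2")
  case True then show ?thesis using sgc_less_sg G by blast
next
  case False
  have "finite (pverts G)" "pverts G \<noteq> {}"
    using G by (auto simp: conn_graph_def pair_graph_def pair_digraph_def
        pair_fin_digraph.pair_finite_verts connected_conv)
  then obtain v where v: "pverts G = {v}"
    using False by (metis One_nat_def Suc_1 card_0_eq card_1_singletonE less_2_cases not_le)
  have "path_between G v v [v]"
    using v by (auto simp: path_between_def vpath_def vwalk_def)
  then have "distance G v v \<le> 0"
    unfolding distance_def by (intro Least_le) (rule exI[of _ "[v]"], simp)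
  then have "diam G = 0" using v by (simp add: diam_def)
  then show ?thesis using d by simp
qed

end

theory Submission
  imports Defs "HOL-Library.Nat_Bijection"
begin

text \<open>
  In both constructions the number of vertices forces the core to be large. If \<open>S\<close> is strong geodetic
  and \<open>X\<close> is a core of it, then the \<open>n - |S|\<close> vertices outside \<open>S\<close> are interior to the shortest paths
  fixed for the nonadjacent pairs that meet \<open>X\<close>, and each such path has at most \<open>d - 1\<close> interior
  vertices, where \<open>d\<close> is the diameter.

  For (iii) let \<open>m = k + s\<close> and take a spider with \<open>m\<close> legs whose leaves are pairwise at distance \<open>d\<close>
  (for odd \<open>d\<close> the inner ends of the legs form a clique, for even \<open>d\<close> they are identified).  Blow up
  every vertex other than a leaf to a clique, exactly so large that the shortest paths between the
  pairs of leaves that meet a fixed set of \<open>k\<close> leaves can be chosen internally disjoint and use up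
  all inner vertices.  A leaf is interior to no shortest path, so the leaves are the only sg-set, and
  fewer than \<open>k\<close> leaves meet too few pairs to cover the graph.  Part (i) is the case \<open>d = 2\<close>, \<open>s = 1\<close>.

  For (ii) delete a matching of size \<open>q = n div 3\<close> from the complete graph.  Only the \<open>q\<close> matched pairs
  have shortest paths with an interior vertex, and then exactly one.  Hence an sg-set misses exactly \<open>q\<close>
  vertices and every core meets all the matched pairs.

  The graphs are given by their metric: an integer metric is the distance function of its graph of
  pairs at distance 1 as soon as from every point one can step one unit closer to any other.
\<close>

section \<open>Strong geodetic sets and cores\<close>

lemma sg_eqI:
  assumes "strong_geodetic_set G S" "card S = m"
    and "\<And>T. strong_geodetic_set G T \<Longrightarrow> m \<le> card T"
  shows "sg G = m"
  unfolding sg_def by (rule Least_equality) (use assms in blast)+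

text \<open>\<open>sgc\<close> is a minimum of minima; \<open>le\<close> bounds the inner ones for
  all sg-sets at once.\<close>

lemma sgc_eqI:
  assumes S: "sg_set G S" and X: "strong_geodetic_core G S X" "card X = k"
    and le: "\<And>T X. sg_set G T \<Longrightarrow> strong_geodetic_core G T X \<Longrightarrow> k \<le> card X"
  shows "sgc G = k"
proof -
  have ge: "k \<le> sgc_of G T" if T: "sg_set G T" and "strong_geodetic_core G T Y" for T Y
  proof -
    have "\<exists>Z. strong_geodetic_core G T Z \<and> card Z = sgc_of G T"
      unfolding sgc_of_def by (rule LeastI_ex) (use that in blast)
    then show ?thesis using le[OF T] by metis
  qed
  \<comment> \<open>Every strong geodetic set is a core of itself, so each inner minimum is
    attained.\<close>
  have ex: "\<exists>Y. strong_geodetic_core G T Y" if "sg_set G T" for T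
    using that unfolding sg_set_def strong_geodetic_set_def strong_geodetic_core_def by blast
  have "sgc_of G S \<le> k"
    unfolding sgc_of_def by (rule Least_le) (use X in blast)
  then have "sgc_of G S = k" using ge[OF S X(1)] by simp
  then show ?thesis
    unfolding sgc_def by (intro Least_equality) (use S ge ex in blast)+
qed

lemma strong_geodetic_core_imp_set:
  assumes "strong_geodetic_core G S X" and "S \<subseteq> pverts G"
  shows "strong_geodetic_set G S"
proof -
  obtain g where g: "path_choice G S g" "(\<Union>(u, v)\<in>X \<times> S. set (g {u, v})) = pverts G"
    and X: "X \<subseteq> S"
    using assms(1) unfolding strong_geodetic_core_def by blast
  have "(\<Union>(u, v)\<in>S \<times> S. set (g {u, v})) = pverts G" (is "?U = _")
  proof
    show "?U \<subseteq> pverts G" using path_choiceD(3)[OF g(1)] by blast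
    show "pverts G \<subseteq> ?U" unfolding g(2)[symmetric] using X by blast
  qed
  then show ?thesis unfolding strong_geodetic_set_def using g(1) assms(2) by blast
qed

text \<open>
  The map \<open>A\<close> distributes the vertices outside \<open>S\<close> among pairs meeting \<open>X\<close>; each pair only has
  to cover its own share by a single shortest path.
\<close>

lemma strong_geodetic_coreI:
  assumes G: "conn_graph G" and S: "S \<subseteq> pverts G" and X: "X \<subseteq> S" "X \<noteq> {}"
    and A: "\<And>v. v \<in> pverts G - S \<Longrightarrow> \<exists>x\<in>X. \<exists>y\<in>S. \<exists>p. A v = {x, y} \<and> shortest_path G x y p
              \<and> {w \<in> pverts G - S. A w = {x, y}} \<subseteq> set p"
  shows "strong_geodetic_core G S X"
proof -
  obtain g0 where g0: "path_choice G S g0" using path_choice_exists[OF G S] by blast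
  define P where "P B p \<longleftrightarrow> (\<exists>x y. B = {x, y} \<and> shortest_path G x y p)
      \<and> {w \<in> pverts G - S. A w = B} \<subseteq> set p" for B p
  define h where "h B = (SOME p. P B p)" for B
  \<comment> \<open>Pairs without a share to cover get an arbitrary shortest path.\<close>
  define g where "g B = (if B \<in> A ` (pverts G - S) then h B else g0 B)" for B
  have h: "P B (h B)" if "B \<in> A ` (pverts G - S)" for B
  proof -
    from that obtain v where v: "v \<in> pverts G - S" "B = A v" by blast
    from A[OF v(1)] have "\<exists>p. P B p" unfolding P_def v(2) by metis
    then show ?thesis unfolding h_def by (rule someI_ex)
  qed
  have g: "path_choice G S g"
    unfolding path_choice_def
  proof (intro ballI)
    fix x y assume xy: "x \<in> S" "y \<in> S"
    show "shortest_path G x y (g {x, y}) \<or> shortest_path G y x (g {x, y})"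
    proof (cases "{x, y} \<in> A ` (pverts G - S)")
      case True
      from h[OF True] obtain x' y' where "{x, y} = {x', y'}" "shortest_path G x' y' (h {x, y})"
        unfolding P_def by blast
      then show ?thesis using True by (auto simp: g_def doubleton_eq_iff)
    next
      case False
      then show ?thesis using g0 xy by (simp add: g_def path_choice_def)
    qed
  qed
  have "(\<Union>(u, v)\<in>X \<times> S. set (g {u, v})) = pverts G" (is "?U = _")
  proof
    show "?U \<subseteq> pverts G" using path_choiceD(3)[OF g] X(1) by blast
    show "pverts G \<subseteq> ?U"
    proof
      fix v assume v: "v \<in> pverts G"
      show "v \<in> ?U"
      proof (cases "v \<in> S")
        case True
        \<comment> \<open>A vertex of \<open>S\<close> is an end of its path to any \<open>x\<close>
          in \<open>X\<close>.\<close>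
        obtain x where x: "x \<in> X" using X(2) by blast
        then have "v \<in> set (g {x, v})" using path_choiceD(2)[OF g _ True] X(1) by blast
        then show ?thesis using x True by blast
      next
        case False
        then obtain x y where xy: "x \<in> X" "y \<in> S" "A v = {x, y}" using A v by blast
        have mem: "{x, y} \<in> A ` (pverts G - S)" using False v xy(3)[symmetric] by simp
        have "v \<in> set (g {x, y})" using h[OF mem] mem False v xy(3) unfolding P_def g_def by auto
        then show ?thesis using xy by blast
      qed
    qed
  qed
  then show ?thesis unfolding strong_geodetic_core_def using g X(1) by blast
qed

section \<open>Graphs given by an integer metric\<close>

lemma length_vwalk_to_vpath_le:
  assumes "vwalk p G"
  shows "length (vwalk_to_vpath p) \<le> card (set p)"
proof -
  have "distinct (vwalk_to_vpath p)"
    using vwalk_to_vpath_vpath[OF assms] by (simp add: vpath_def)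
  then have "length (vwalk_to_vpath p) = card (set (vwalk_to_vpath p))"
    by (simp add: distinct_card)
  also have "\<dots> \<le> card (set p)"
    by (intro card_mono) (auto dest: vwalk_to_vpath_subset)
  finally show ?thesis .
qed

lemma vwalk_arcs_map_upt:
  "vwalk_arcs (map q [0..<Suc l]) = map (\<lambda>i. (q i, q (Suc i))) [0..<l]"
proof (induction l)
  case (Suc l)
  have "vwalk_arcs (map q [0..<Suc (Suc l)]) = vwalk_arcs (map q [0..<Suc l] @ [q (Suc l)])"
    by simp
  also have "\<dots> = vwalk_arcs (map q [0..<Suc l]) @ [(q l, q (Suc l))]"
    by (subst vwalk_arcs_append) auto
  finally show ?case using Suc by simp
qed simp

locale graph_metric =
  fixes V :: "'a set" and D :: "'a \<Rightarrow> 'a \<Rightarrow> nat"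
  assumes finite_V: "finite V" and nonempty_V: "V \<noteq> {}"
    and D_eq_0: "x \<in> V \<Longrightarrow> y \<in> V \<Longrightarrow> D x y = 0 \<longleftrightarrow> x = y"
    and D_sym: "x \<in> V \<Longrightarrow> y \<in> V \<Longrightarrow> D x y = D y x"
    and D_triangle: "x \<in> V \<Longrightarrow> y \<in> V \<Longrightarrow> z \<in> V \<Longrightarrow> D x z \<le> D x y + D y z"
    and D_descent: "x \<in> V \<Longrightarrow> y \<in> V \<Longrightarrow> D x y \<ge> 2 \<Longrightarrow>
                      \<exists>w\<in>V. D x w = 1 \<and> Suc (D w y) = D x y"
begin

definition graph :: "'a pair_pre_digraph" where
  "graph = \<lparr> pverts = V, parcs = {(x, y). x \<in> V \<and> y \<in> V \<and> D x y = 1} \<rparr>"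

lemma pverts_graph [simp]: "pverts graph = V"
  by (simp add: graph_def)

lemma vwalk_graph_iff:
  "vwalk p (with_proj graph) \<longleftrightarrow>
     p \<noteq> [] \<and> set p \<subseteq> V \<and> (\<forall>(x, y)\<in>set (vwalk_arcs p). D x y = 1)"
  using arcs_in_vwalk_arcs[of _ p] unfolding vwalk_def by (fastforce simp: graph_def)

lemma pair_graph_graph: "pair_graph graph"
proof
  show "finite (parcs graph)"
    by (rule finite_subset[of _ "V \<times> V"]) (auto simp: graph_def finite_V)
  show "symmetric (with_proj graph)"
    by (auto simp: symmetric_def sym_def graph_def D_sym)
qed (use D_eq_0 finite_V in \<open>fastforce simp: graph_def\<close>)+

lemma ex_vwalk:
  assumes "x \<in> V" "y \<in> V"
  shows "\<exists>p. vwalk p (with_proj graph) \<and> hd p = x \<and> last p = y \<and> length p = Suc (D x y)"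
  using assms
proof (induction "D x y" arbitrary: x)
  case 0
  then show ?case by (intro exI[of _ "[x]"]) (auto simp: vwalk_graph_iff D_eq_0)
next
  case (Suc l)
  have "\<exists>w\<in>V. D x w = 1 \<and> Suc (D w y) = D x y"
  proof (cases "D x y \<ge> 2")
    case True
    then show ?thesis using D_descent Suc.prems by blast
  next
    case False
    then have "D x y = 1" using Suc.hyps(2) by simp
    \<comment> \<open>Here the next vertex is \<open>y\<close> itself.\<close>
    then show ?thesis using D_eq_0[of y y] Suc.prems by force
  qed
  then obtain w where w: "w \<in> V" "D x w = 1" "Suc (D w y) = D x y" by blast
  then obtain p where p: "vwalk p (with_proj graph)" "hd p = w" "last p = y" "length p = Suc (D w y)"
    using Suc.hyps(1)[of w] Suc.hyps(2) Suc.prems(2) by auto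
  then have "vwalk (x # p) (with_proj graph)"
    using w Suc.prems by (auto simp: vwalk_graph_iff)
  then show ?case
    using p w by (intro exI[of _ "x # p"]) (auto simp: vwalk_graph_iff)
qed

text \<open>Triangle inequality along arcs of length 1; strict because a list has one vertex more
  than arcs.\<close>

lemma D_le_vwalk:
  assumes "vwalk p (with_proj graph)"
  shows "D (hd p) (last p) < length p"
  using assms
proof (induction p rule: vwalk_arcs.induct)
  case (3 x y zs)
  then have "x \<in> V" "y \<in> V" "last (y # zs) \<in> V" "D x y = 1"
      and "D y (last (y # zs)) < length (y # zs)"
    using last_in_set[of "y # zs"] by (auto simp: vwalk_graph_iff)
  then show ?case using D_triangle[of x y "last (y # zs)"] by simp
qed (auto simp: vwalk_graph_iff D_eq_0)

lemma conn_graph: "conn_graph graph"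
proof -
  interpret pair_graph graph by (rule pair_graph_graph)
  have "x \<rightarrow>\<^sup>*\<^bsub>with_proj graph\<^esub> y" if "x \<in> V" "y \<in> V" for x y
    using ex_vwalk[OF that] vwalk_imp_ex_vpath reachable_vpath_conv by metis
  then have "Digraph_Component.connected (with_proj graph)"
    using nonempty_V by (auto simp: connected_def strongly_connected_def intro: reachable_mk_symmetricI)
  then show ?thesis
    using pair_graph_graph by (simp add: conn_graph_def)
qed

text \<open>A walk with \<open>Suc (D x y)\<close> vertices repeats none: cutting out a cycle would
  beat the lower bound \<open>D_le_vwalk\<close>. Hence distinctness never has to be checked
  later.\<close>

lemma shortest_path_iff:
  assumes "x \<in> V" "y \<in> V"
  shows "shortest_path graph x y p \<longleftrightarrow>
    vwalk p (with_proj graph) \<and> hd p = x \<and> last p = y \<and> length p = Suc (D x y)" (is "_ \<longleftrightarrow> ?R")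
proof
  assume sp: "shortest_path graph x y p"
  then have p: "vwalk p (with_proj graph)" "hd p = x" "last p = y"
    by (auto simp: shortest_path_def path_between_def vpath_def)
  obtain q where q: "vwalk q (with_proj graph)" "hd q = x" "last q = y" "length q = Suc (D x y)"
    using ex_vwalk assms by blast
  have "path_between graph x y (vwalk_to_vpath q)"
    using q by (simp add: path_between_def vwalk_to_vpath_hd vwalk_to_vpath_last vwalk_to_vpath_vpath)
  then have "length p - 1 \<le> length (vwalk_to_vpath q) - 1"
    using sp unfolding shortest_path_def by auto
  also have "\<dots> \<le> D x y"
    using length_vwalk_to_vpath_le[OF q(1)] card_length[of q] q(4) by linarith
  finally show ?R using D_le_vwalk[OF p(1)] p by auto
next
  assume p: ?R
  have min: "length p \<le> length q" if "vwalk q (with_proj graph)" "hd q = x" "last q = y" for q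
    using D_le_vwalk[OF that(1)] that p by simp
  have "distinct p"
  proof (rule ccontr)
    assume "\<not> distinct p"
    then have "card (set p) < length p"
      using card_length[of p] card_distinct[of p] by linarith
    then have "length (vwalk_to_vpath p) < length p"
      using length_vwalk_to_vpath_le[of p] p by fastforce
    then show False
      using min[of "vwalk_to_vpath p"] vwalk_to_vpath_vpath[of p] p
      by (auto simp: vpath_def vwalk_to_vpath_hd vwalk_to_vpath_last)
  qed
  moreover have "length p - 1 \<le> length q - 1"
    if "vwalk q (with_proj graph)" "hd q = x" "last q = y" for q
    using min[OF that] by (rule diff_le_mono)
  ultimately show "shortest_path graph x y p"
    using p by (simp add: shortest_path_def path_between_def vpath_def)
qed

lemma shortest_path_map_upt:
  assumes "\<And>t. t \<le> l \<Longrightarrow> q t \<in> V" "\<And>t. t < l \<Longrightarrow> D (q t) (q (Suc t)) = 1" "D (q 0) (q l) = l"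
  shows "shortest_path graph (q 0) (q l) (map q [0..<Suc l])"
proof -
  have "vwalk (map q [0..<Suc l]) (with_proj graph)"
    unfolding vwalk_graph_iff vwalk_arcs_map_upt using assms by auto
  then show ?thesis
    using assms by (subst shortest_path_iff) (auto simp: hd_map last_map simp del: upt_Suc)
qed

lemma distance_graph:
  assumes "x \<in> V" "y \<in> V"
  shows "distance graph x y = D x y"
proof -
  obtain p where p: "shortest_path graph x y p"
    using shortest_path_exists[OF conn_graph] assms by auto
  then have len: "vwalk_length p = D x y" using shortest_path_iff assms by simp
  show ?thesis unfolding distance_def
  proof (rule Least_equality)
    show "\<exists>p. path_between graph x y p \<and> vwalk_length p = D x y"
      using p len unfolding shortest_path_def by blast
    show "D x y \<le> l" if "\<exists>p. path_between graph x y p \<and> vwalk_length p = l" for l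
      using that p len unfolding shortest_path_def by metis
  qed
qed

lemma diam_graph:
  assumes "\<And>x y. x \<in> V \<Longrightarrow> y \<in> V \<Longrightarrow> D x y \<le> d" and "x \<in> V" "y \<in> V" "D x y = d"
  shows "diam graph = d"
proof -
  have eq: "{distance graph x y | x y. x \<in> pverts graph \<and> y \<in> pverts graph}
      = (\<lambda>(x, y). D x y) ` (V \<times> V)"
    using distance_graph by force
  show ?thesis
    unfolding diam_def eq by (rule Max_eqI) (use assms finite_V in auto)
qed

section \<open>Counting the vertices covered by shortest paths\<close>

text \<open>Cutting at \<open>v\<close> leaves two walks, no shorter than \<open>D x v\<close> and
  \<open>D v y\<close>.\<close>

lemma shortest_path_between:
  assumes p: "shortest_path graph x y p" and xy: "x \<in> V" "y \<in> V" and v: "v \<in> set p"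
  shows "D x v + D v y = D x y"
proof -
  have w: "vwalk p (with_proj graph)" "hd p = x" "last p = y" "length p = Suc (D x y)"
    using p xy by (simp_all add: shortest_path_iff)
  obtain p1 p2 where eq: "p = p1 @ v # p2" using v by (meson split_list)
  have "vwalk (p1 @ [v]) (with_proj graph)" "vwalk (v # p2) (with_proj graph)"
    using w(1) vwalkI_append_l[of "p1 @ [v]" p2] vwalkI_append_r[of "v # p2" p1]
    unfolding eq by simp_all
  from this[THEN D_le_vwalk] have "D x v \<le> length p1" "D v y \<le> length p2"
    using w(2,3) unfolding eq by (auto simp: hd_append split: if_splits)
  moreover have "v \<in> V" using w(1) v by (auto simp: vwalk_graph_iff)
  ultimately show ?thesis
    using D_triangle[of x v y] xy w(4) unfolding eq by simp
qed

text \<open>A path between adjacent vertices has no interior, so only pairs at distance at least 2 count.\<close>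

lemma card_covered_le:
  assumes g: "path_choice graph S g" and S: "S \<subseteq> V" and X: "X \<subseteq> S"
    and cov: "V \<subseteq> (\<Union>(u, v)\<in>X \<times> S. set (g {u, v}))"
    and d: "\<And>x y. x \<in> V \<Longrightarrow> y \<in> V \<Longrightarrow> D x y \<le> d"
  shows "card (V - S) \<le> (d - 1) * card {{x, y} | x y. x \<in> X \<and> y \<in> S \<and> 2 \<le> D x y}"
    (is "_ \<le> _ * card ?E")
proof -
  have fin: "finite ?E"
    by (rule finite_subset[of _ "Pow V"]) (use S X finite_V in auto)
  have sp: "shortest_path graph x y (g {x, y}) \<or> shortest_path graph y x (g {x, y})"
    if "x \<in> X" "y \<in> S" for x y
    using g that X unfolding path_choice_def by blast
  have len: "length (g {x, y}) = Suc (D x y)" if "x \<in> X" "y \<in> S" for x y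
  proof -
    have "x \<in> V" "y \<in> V" using that S X by auto
    then show ?thesis
      using sp[OF that] shortest_path_iff[of x y] shortest_path_iff[of y x] D_sym[of x y] by auto
  qed
  \<comment> \<open>A vertex outside \<open>S\<close> is covered strictly between the ends of its
    path, which are then at distance at least 2.\<close>
  have "V - S \<subseteq> (\<Union>B\<in>?E. set (g B) - B)"
  proof
    fix v assume v: "v \<in> V - S"
    then obtain x y where xy: "x \<in> X" "y \<in> S" "v \<in> set (g {x, y})" using cov by blast
    then have xyV: "x \<in> V" "y \<in> V" using S X by auto
    have "D x v + D v y = D x y"
      using sp[OF xy(1,2)]
        shortest_path_between[OF _ xyV xy(3)] shortest_path_between[OF _ xyV(2,1) xy(3)]
        D_sym[of x v] D_sym[of y v] D_sym[of x y] v xyV by auto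
    moreover have "D x v \<noteq> 0" "D v y \<noteq> 0" "v \<noteq> x" "v \<noteq> y"
      using D_eq_0 v xyV xy X by auto
    ultimately have "2 \<le> D x y" by linarith
    then show "v \<in> (\<Union>B\<in>?E. set (g B) - B)"
      using xy v X by blast
  qed
  then have "card (V - S) \<le> card (\<Union>B\<in>?E. set (g B) - B)"
    using fin by (intro card_mono) auto
  also have "\<dots> \<le> (\<Sum>B\<in>?E. card (set (g B) - B))"
    by (rule card_UN_le[OF fin])
  also have "\<dots> \<le> (\<Sum>B\<in>?E. d - 1)"
  proof (rule sum_mono)
    fix B assume "B \<in> ?E"
    then obtain x y where xy: "x \<in> X" "y \<in> S" "2 \<le> D x y" "B = {x, y}" by blast
    have V: "x \<in> V" "y \<in> V" using xy S X by auto
    then have "x \<noteq> y" using xy(3) D_eq_0 by fastforce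
    have "B \<subseteq> set (g B)"
      using path_choiceD(1,2)[OF g, of x y] xy X by auto
    \<comment> \<open>The path has \<open>Suc (D x y)\<close> vertices, two of which are its
      ends.\<close>
    then have "card (set (g B) - B) = card (set (g B)) - 2"
      using \<open>x \<noteq> y\<close> xy(4) by (subst card_Diff_subset) auto
    also have "\<dots> \<le> D x y - 1"
      using card_length[of "g B"] len[OF xy(1,2)] xy(4) by simp
    also have "\<dots> \<le> d - 1" using d[OF V] by simp
    finally show "card (set (g B) - B) \<le> d - 1" .
  qed
  finally show ?thesis by (simp add: mult.commute)
qed

lemma card_sg_set_le:
  assumes "strong_geodetic_set graph S"
    and "\<And>x y. x \<in> V \<Longrightarrow> y \<in> V \<Longrightarrow> D x y \<le> d"
  shows "card (V - S) \<le> (d - 1) * card {{x, y} | x y. x \<in> S \<and> y \<in> S \<and> 2 \<le> D x y}"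
  using assms card_covered_le[of S _ S d] unfolding strong_geodetic_set_def pverts_graph by blast

lemma card_core_le:
  assumes "strong_geodetic_core graph S X" and "S \<subseteq> V"
    and "\<And>x y. x \<in> V \<Longrightarrow> y \<in> V \<Longrightarrow> D x y \<le> d"
  shows "card (V - S) \<le> (d - 1) * card {{x, y} | x y. x \<in> X \<and> y \<in> S \<and> 2 \<le> D x y}"
  using assms card_covered_le[of S _ X d] unfolding strong_geodetic_core_def pverts_graph by blast

text \<open>A vertex interior to no shortest path is covered only as an end, and ends lie in
  \<open>S\<close>.\<close>

lemma extreme_in_strong_geodetic_set:
  assumes S: "strong_geodetic_set graph S" and s: "s \<in> V"
    and ext: "\<And>x y. x \<in> V \<Longrightarrow> y \<in> V \<Longrightarrow> D x s + D s y = D x y \<Longrightarrow> x = s \<or> y = s"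
  shows "s \<in> S"
proof -
  obtain g where g: "path_choice graph S g" "(\<Union>(x, y)\<in>S \<times> S. set (g {x, y})) = V" and SV: "S \<subseteq> V"
    using S unfolding strong_geodetic_set_def by auto
  have "s \<in> (\<Union>(x, y)\<in>S \<times> S. set (g {x, y}))" using g(2) s by simp
  then obtain x y where xy: "x \<in> S" "y \<in> S" "s \<in> set (g {x, y})" by blast
  then have "D x s + D s y = D x y \<or> D y s + D s x = D y x"
    using g(1) shortest_path_between SV unfolding path_choice_def by blast
  then show ?thesis using ext xy SV by blast
qed

end

section \<open>Complete graphs minus a matching\<close>

text \<open>The missing edges are \<open>{i, i + q}\<close> for \<open>i < q\<close>; vertices from
  \<open>2 * q\<close> on are unmatched.\<close>

definition matching_dist :: "nat \<Rightarrow> nat \<Rightarrow> nat \<Rightarrow> nat" where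
  "matching_dist q u v =
     (if u = v then 0 else if u < q \<and> v = u + q \<or> v < q \<and> u = v + q then 2 else 1)"

lemma graph_metric_matching:
  assumes "2 * q < n"
  shows "graph_metric {..<n} (matching_dist q)"
proof
  fix x y assume "x \<in> {..<n}" "y \<in> {..<n}" "2 \<le> matching_dist q x y"
  then show "\<exists>w\<in>{..<n}. matching_dist q x w = 1 \<and> Suc (matching_dist q w y) = matching_dist q x y"
    \<comment> \<open>The unmatched vertex \<open>2 * q\<close> is adjacent to all others.\<close>
    using assms by (intro bexI[of _ "2 * q"]) (auto simp: matching_dist_def split: if_splits)
qed (use assms in \<open>auto simp: matching_dist_def\<close>)

text \<open>\<open>S\<close> omits the \<open>q\<close> unmatched vertices \<open>2 * q + i\<close>,
  \<open>i < q\<close>, and each serves as the midpoint for \<open>i\<close> and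
  \<open>i + q\<close>.\<close>

lemma complete_minus_matching:
  assumes q: "q \<ge> 1" and n: "3 * q \<le> n"
  shows "\<exists>G :: nat pair_pre_digraph. conn_graph G \<and> order G = n \<and> sgc G = q \<and> sg G = n - q"
proof -
  interpret graph_metric "{..<n}" "matching_dist q"
    using graph_metric_matching q n by simp
  define S where "S = {..<n} - {2 * q..<3 * q}"
  have D2: "matching_dist q x y \<le> 2" for x y by (simp add: matching_dist_def)
  have S: "S \<subseteq> {..<n}" "card S = n - q"
    using n by (auto simp: S_def card_Diff_subset subset_iff)
  have core: "strong_geodetic_core graph S {..<q}"
  proof (rule strong_geodetic_coreI[where A = "\<lambda>v. {v - 2 * q, v - q}", OF conn_graph])
    fix v assume "v \<in> pverts graph - S"
    then have v: "2 * q \<le> v" "v < 3 * q" by (auto simp: S_def)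
    have "shortest_path graph (v - 2 * q) (v - q) [v - 2 * q, v, v - q]"
      using v n q by (subst shortest_path_iff) (auto simp: vwalk_graph_iff matching_dist_def)
    moreover have "{w \<in> pverts graph - S. {w - 2 * q, w - q} = {v - 2 * q, v - q}} \<subseteq> {v}"
      using v q by (auto simp: S_def doubleton_eq_iff)
    moreover have "v - 2 * q \<in> {..<q}" "v - q \<in> S"
      using v n by (auto simp: S_def)
    ultimately show "\<exists>x\<in>{..<q}. \<exists>y\<in>S. \<exists>p. {v - 2 * q, v - q} = {x, y} \<and> shortest_path graph x y p
        \<and> {w \<in> pverts graph - S. {w - 2 * q, w - q} = {x, y}} \<subseteq> set p"
      by (intro bexI[of _ "v - 2 * q"] bexI[of _ "v - q"] exI[of _ "[v - 2 * q, v, v - q]"]) auto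
  qed (use S q n in \<open>auto simp: S_def lessThan_empty_iff\<close>)
  have sgs: "strong_geodetic_set graph S"
    using strong_geodetic_core_imp_set[OF core] S by simp
  have sg: "sg graph = n - q"
  proof (rule sg_eqI[OF sgs S(2)])
    fix T assume T: "strong_geodetic_set graph T"
    \<comment> \<open>Only the \<open>q\<close> matched pairs are at distance 2, so at most
      \<open>q\<close> vertices lie outside \<open>T\<close>.\<close>
    have "{{x, y} | x y. x \<in> T \<and> y \<in> T \<and> 2 \<le> matching_dist q x y} \<subseteq> (\<lambda>i. {i, i + q}) ` {..<q}"
      by (auto simp: matching_dist_def split: if_splits)
    from card_mono[OF _ this] have "card ({..<n} - T) \<le> q"
      using card_sg_set_le[OF T, of 2] D2 card_image_le[of "{..<q}" "\<lambda>i. {i, i + q}"] by simp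
    moreover have "T \<subseteq> {..<n}" using T by (simp add: strong_geodetic_set_def)
    ultimately show "n - q \<le> card T"
      by (simp add: card_Diff_subset finite_subset)
  qed
  have "sgc graph = q"
  proof (rule sgc_eqI[OF _ core])
    show "sg_set graph S" using sgs S sg by (simp add: sg_set_def)
    fix T X assume T: "sg_set graph T" and X: "strong_geodetic_core graph T X"
    have TV: "T \<subseteq> {..<n}" "card T = n - q" "X \<subseteq> T"
      using T X sg by (auto simp: sg_set_def strong_geodetic_set_def strong_geodetic_core_def)
    then have fin: "finite T" "finite X" by (auto dest: finite_subset)
    \<comment> \<open>A vertex lies in at most one matched pair, so at most \<open>card X\<close>
      pairs are available for the \<open>q\<close> vertices outside \<open>T\<close>.\<close>
    have "{{x, y} | x y. x \<in> X \<and> y \<in> T \<and> 2 \<le> matching_dist q x y}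
        \<subseteq> (\<lambda>x. {x, if x < q then x + q else x - q}) ` X"
      by (auto simp: matching_dist_def split: if_splits)
    from card_mono[OF _ this] have "card ({..<n} - T) \<le> card X"
      using card_core_le[OF X TV(1), of 2] D2 fin
        card_image_le[of X "\<lambda>x. {x, if x < q then x + q else x - q}"] by simp
    then show "q \<le> card X"
      using TV fin n by (simp add: card_Diff_subset)
  qed simp
  then show ?thesis using sg conn_graph by (intro exI[of _ graph]) simp
qed

section \<open>Blown-up spiders\<close>

text \<open>Sort the pairs by least element: \<open>m - 1 - i\<close> of them have least element
  \<open>i\<close>, the rest avoid the first \<open>k\<close> elements.\<close>

lemma sum_lessThan_add_choose_two:
  assumes "k \<le> m"
  shows "(\<Sum>i<k. m - 1 - i) + (m - k choose 2) = (m choose 2)"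
  using assms
proof (induction k)
  case (Suc k)
  then have "(m - k choose 2) = (m - Suc k) + (m - Suc k choose 2)"
    by (simp add: Suc_diff_Suc[symmetric] numeral_2_eq_2)
  then show ?case using Suc by simp
qed simp

lemma sum_lessThan_double:
  assumes "k < m"
  shows "2 * real (\<Sum>i<k. m - 1 - i) = real k * (2 * real m - real k - 1)"
  using assms by (induction k) (auto simp: of_nat_diff algebra_simps)

text \<open>The radicand is the square of \<open>2 * m - 1 - 2 * k\<close>, positive as
  \<open>k < m\<close>, so the ceiling is taken of exactly \<open>k\<close>.\<close>

lemma ceiling_formula:
  assumes k: "k < m" and d: "2 \<le> d"
  shows "\<lceil>real m - (1 + sqrt ((2 * real m - 1)\<^sup>2
           - 8 * real ((d - 1) * (\<Sum>i<k. m - 1 - i)) / (real d - 1))) / 2\<rceil> = int k"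
proof -
  have "8 * real ((d - 1) * (\<Sum>i<k. m - 1 - i)) / (real d - 1)
      = 4 * (2 * real (\<Sum>i<k. m - 1 - i))"
    using d by (simp add: of_nat_diff del: of_nat_sum)
  also have "\<dots> = 4 * (real k * (2 * real m - real k - 1))"
    by (simp only: sum_lessThan_double[OF k])
  finally have "(2 * real m - 1)\<^sup>2 - 8 * real ((d - 1) * (\<Sum>i<k. m - 1 - i)) / (real d - 1)
      = (2 * real m - 1 - 2 * real k)\<^sup>2"
    by (simp add: power2_eq_square algebra_simps)
  moreover have "sqrt ((2 * real m - 1 - 2 * real k)\<^sup>2) = 2 * real m - 1 - 2 * real k"
    using k by simp
  ultimately show ?thesis by (simp add: field_simps)
qed

text \<open>The pairs that miss \<open>X\<close> are those of \<open>S - X\<close>.\<close>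

lemma card_pairs_meeting:
  assumes "finite S" "X \<subseteq> S"
  shows "card {B. B \<subseteq> S \<and> card B = 2 \<and> B \<inter> X \<noteq> {}} + (card S - card X choose 2)
       = (card S choose 2)"
proof -
  let ?P = "\<lambda>A. {B. B \<subseteq> A \<and> card B = 2}"
  have "{B. B \<subseteq> S \<and> card B = 2 \<and> B \<inter> X \<noteq> {}} = ?P S - ?P (S - X)" by blast
  moreover have "?P (S - X) \<subseteq> ?P S" "finite (?P S)"
    using assms by auto
  ultimately have "card {B. B \<subseteq> S \<and> card B = 2 \<and> B \<inter> X \<noteq> {}} + card (?P (S - X)) = card (?P S)"
    by (simp add: card_Diff_subset card_mono finite_subset)
  moreover have "card (S - X) = card S - card X"
    using assms by (simp add: card_Diff_subset finite_subset)
  ultimately show ?thesis using assms by (simp add: n_subsets)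
qed

text \<open>
  For \<open>i < j\<close> and \<open>0 < t < d\<close>, \<open>enc i j t\<close> is the \<open>t\<close>-th vertex on the path from leaf \<open>i\<close> to leaf \<open>j\<close>;
  \<open>enc i i 0\<close> is leaf \<open>i\<close> itself.  The label \<open>(i, a)\<close> is the position in the spider before the
  blow-up: on leg \<open>i\<close> at distance \<open>a\<close> from its leaf.
\<close>

locale spider =
  fixes m k d :: nat
  assumes k_pos: "1 \<le> k" and k_less: "k < m" and d_ge_2: "2 \<le> d"
begin

definition enc :: "nat \<Rightarrow> nat \<Rightarrow> nat \<Rightarrow> nat" where
  "enc i j t = prod_encode (i, prod_encode (j, t))"

abbreviation leaf :: "nat \<Rightarrow> nat" where
  "leaf i \<equiv> enc i i 0"

definition label :: "nat \<Rightarrow> nat \<times> nat" where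
  "label v = (let (i, z) = prod_decode v; (j, t) = prod_decode z
              in if 2 * t \<le> d then (i, t) else (j, d - t))"

text \<open>The leaves whose fixed path must cover \<open>v\<close>; this is the map
  \<open>A\<close> for \<open>strong_geodetic_coreI\<close>.\<close>

definition ends :: "nat \<Rightarrow> nat set" where
  "ends v = (let (i, z) = prod_decode v; (j, t) = prod_decode z in {leaf i, leaf j})"

text \<open>On one leg this is \<open>|a - b|\<close>. Between legs \<open>d - a - b\<close> never
  truncates, as positions are at most \<open>d / 2\<close>; it is 0 between two centre labels if
  \<open>d\<close> is even.\<close>

fun label_dist :: "nat \<times> nat \<Rightarrow> nat \<times> nat \<Rightarrow> nat" where
  "label_dist (i, a) (j, b) = (if i = j then (a - b) + (b - a) else d - a - b)"

text \<open>\<open>max 1\<close> makes distinct vertices with labels at distance 0 adjacent: this is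
  the blow-up to cliques.\<close>

definition vdist :: "nat \<Rightarrow> nat \<Rightarrow> nat" where
  "vdist u v = (if u = v then 0 else max 1 (label_dist (label u) (label v)))"

definition leaves :: "nat set" where
  "leaves = leaf ` {..<m}"

text \<open>One interior of a path for each pair of leaves that meets the first
  \<open>k\<close>.\<close>

definition inner :: "nat set" where
  "inner = (\<lambda>(i, j, t). enc i j t) ` (SIGMA i:{..<k}. {i<..<m} \<times> {0<..<d})"

lemma enc_inject [simp]: "enc i j t = enc i' j' t' \<longleftrightarrow> i = i' \<and> j = j' \<and> t = t'"
  by (auto simp: enc_def prod_encode_eq)

lemma label_enc [simp]: "label (enc i j t) = (if 2 * t \<le> d then (i, t) else (j, d - t))"
  by (simp add: label_def enc_def)

lemma ends_enc [simp]: "ends (enc i j t) = {leaf i, leaf j}"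
  by (simp add: ends_def enc_def)

lemma leaf_in_leaves [simp]: "i < m \<Longrightarrow> leaf i \<in> leaves"
  by (simp add: leaves_def)

lemma enc_in_inner [simp]: "i < k \<Longrightarrow> i < j \<Longrightarrow> j < m \<Longrightarrow> 0 < t \<Longrightarrow> t < d \<Longrightarrow> enc i j t \<in> inner"
  unfolding inner_def by (rule image_eqI[of _ _ "(i, j, t)"]) auto

lemma innerE:
  assumes "v \<in> inner"
  obtains i j t where "v = enc i j t" "i < k" "i < j" "j < m" "0 < t" "t < d"
  using assms unfolding inner_def by auto

lemma leavesE:
  assumes "v \<in> leaves"
  obtains i where "v = leaf i" "i < m"
  using assms unfolding leaves_def by auto

lemma disjoint_leaves_inner: "leaves \<inter> inner = {}"
  by (auto elim!: innerE leavesE)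

lemma finite_leaves: "finite leaves" and finite_inner: "finite inner"
  by (simp_all add: leaves_def inner_def)

lemma card_leaves: "card leaves = m"
  by (simp add: leaves_def card_image inj_on_def)

lemma card_inner: "card inner = (d - 1) * (\<Sum>i<k. m - 1 - i)"
proof -
  have "card inner = card (SIGMA i:{..<k}. {i<..<m} \<times> {0<..<d})"
    unfolding inner_def by (rule card_image) (auto simp: inj_on_def)
  also have "\<dots> = (\<Sum>i<k. card ({i<..<m} \<times> {0<..<d}))"
    by (rule card_SigmaI) auto
  also have "\<dots> = (\<Sum>i<k. (d - 1) * (m - 1 - i))"
    by (intro sum.cong) (simp_all add: card_cartesian_product)
  finally show ?thesis by (simp add: sum_distrib_left)
qed

section \<open>The metric of the blown-up spider\<close>

lemma label_valid:
  assumes "v \<in> leaves \<union> inner" "label v = (i, a)"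
  shows "i < m \<and> 2 * a \<le> d"
  using assms k_less by (auto elim!: innerE leavesE split: if_splits)

text \<open>Leaves are not blown up: inner vertices have \<open>0 < t < d\<close>.\<close>

lemma label_eq_0:
  assumes "v \<in> leaves \<union> inner" "label v = (i, 0)"
  shows "v = leaf i"
  using assms by (auto elim!: innerE leavesE split: if_splits)

text \<open>
  For even \<open>d\<close> the labels \<open>(i, d div 2)\<close> all denote the centre of the spider, which is why the
  vertex found here need not carry the label itself.
\<close>

lemma ex_label:
  assumes i: "i < m" and a: "2 * a \<le> d"
  shows "\<exists>w\<in>leaves \<union> inner. \<forall>y\<in>leaves \<union> inner. 
           label_dist (label w) (label y) = label_dist (i, a) (label y) \<and>
           label_dist (label y) (label w) = label_dist (label y) (i, a)"
proof -
  consider "a = 0" | "a > 0" "i < k" | "a > 0" "k \<le> i" "2 * a = d" | "a > 0" "k \<le> i" "2 * a < d"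
    using a by linarith
  then show ?thesis
  proof cases
    case 1
    then show ?thesis using i by (intro bexI[of _ "leaf i"]) auto
  next
    case 2
    then show ?thesis using a d_ge_2 k_less by (intro bexI[of _ "enc i (m - 1) a"]) auto
  next
    case 3
    \<comment> \<open>At the centre the leg in the label is immaterial, so a vertex on leg 0
      serves.\<close>
    have "label_dist (0, a) l = label_dist (i, a) l \<and> label_dist l (0, a) = label_dist l (i, a)"
      if "2 * snd l \<le> d" for l
      using 3(3) that by (cases l) auto
    then show ?thesis
      using 3 i k_pos d_ge_2 label_valid by (intro bexI[of _ "enc 0 i a"]) (auto simp: prod_eq_iff)
  next
    case 4
    \<comment> \<open>From \<open>k\<close> on, a leg is only ever the second leg of a path, counted
      backwards.\<close>
    then have "label (enc 0 i (d - a)) = (i, a)" "enc 0 i (d - a) \<in> inner"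
      using i k_pos by auto
    then show ?thesis by (metis UnI2)
  qed
qed

lemma label_dist_triangle:
  assumes "2 * a \<le> d" "2 * b \<le> d" "2 * c \<le> d"
  shows "label_dist (i, a) (l, c) \<le> label_dist (i, a) (j, b) + label_dist (j, b) (l, c)"
  using assms by auto

lemma label_dist_sym: "label_dist l l' = label_dist l' l"
  by (cases l; cases l') auto

lemma vdist_sym: "vdist x y = vdist y x"
  using label_dist_sym[of "label x" "label y"] by (auto simp: vdist_def)

lemma label_step:
  assumes "i < m" "2 * a \<le> d" "j < m" "2 * b \<le> d" "2 \<le> label_dist (i, a) (j, b)"
  shows "\<exists>l c. l < m \<and> 2 * c \<le> d \<and> label_dist (i, a) (l, c) = 1
           \<and> Suc (label_dist (l, c) (j, b)) = label_dist (i, a) (j, b)"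
proof -
  \<comment> \<open>Move along the common leg; otherwise go inwards while there is room, then cross
    to position \<open>d - Suc a\<close> on leg \<open>j\<close>.\<close>
  consider "i = j" "b < a" | "i = j" "a < b" | "i \<noteq> j" "2 * Suc a \<le> d" | "i \<noteq> j" "d < 2 * Suc a"
    using assms(5) by (cases "i = j") (auto, linarith+)
  then show ?thesis
  proof cases
    case 1
    then show ?thesis using assms by (intro exI[of _ i] exI[of _ "a - 1"]) auto
  next
    case 2
    then show ?thesis using assms by (intro exI[of _ i] exI[of _ "Suc a"]) auto
  next
    case 3
    then show ?thesis using assms by (intro exI[of _ i] exI[of _ "Suc a"]) auto
  next
    case 4
    then show ?thesis using assms by (intro exI[of _ j] exI[of _ "d - Suc a"]) auto
  qed
qed

sublocale graph_metric "leaves \<union> inner" vdist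
proof
  show "finite (leaves \<union> inner)" using finite_leaves finite_inner by simp
  show "leaves \<union> inner \<noteq> {}" using k_less by (auto simp: leaves_def lessThan_empty_iff)
  fix x y assume xy: "x \<in> leaves \<union> inner" "y \<in> leaves \<union> inner"
  show "vdist x y = 0 \<longleftrightarrow> x = y" by (simp add: vdist_def)
  show "vdist x y = vdist y x" by (rule vdist_sym)
  obtain i a where x: "label x = (i, a)" by fastforce
  obtain j b where y: "label y = (j, b)" by fastforce
  note valid = label_valid[OF xy(1) x] label_valid[OF xy(2) y]
  show "vdist x z \<le> vdist x y + vdist y z" if z: "z \<in> leaves \<union> inner" for z
  proof -
    obtain l c where lc: "label z = (l, c)" by fastforce
    have "label_dist (label x) (label z) \<le> label_dist (label x) (label y) + label_dist (label y) (label z)"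
      using label_dist_triangle[of a b c i l j] valid label_valid[OF z lc] by (simp only: x y lc)
    then show ?thesis by (auto simp: vdist_def)
  qed
  show "\<exists>w\<in>leaves \<union> inner. vdist x w = 1 \<and> Suc (vdist w y) = vdist x y" if ge: "2 \<le> vdist x y"
  proof -
    have D: "2 \<le> label_dist (i, a) (j, b)" "vdist x y = label_dist (i, a) (j, b)"
      using ge unfolding vdist_def x y by (auto split: if_splits simp del: label_dist.simps)
    then obtain l c where lc: "l < m" "2 * c \<le> d" "label_dist (i, a) (l, c) = 1"
        "Suc (label_dist (l, c) (j, b)) = label_dist (i, a) (j, b)"
      using label_step[of i a j b] valid by blast
    obtain w where w: "w \<in> leaves \<union> inner" "label_dist (i, a) (label w) = 1"
        "Suc (label_dist (label w) (j, b)) = label_dist (i, a) (j, b)"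
      using ex_label[OF lc(1,2)] xy lc(3,4) x y by metis
    \<comment> \<open>Labels at distance at least 1 belong to distinct vertices, and there
      \<open>max 1\<close> has no effect.\<close>
    have "w \<noteq> x" "w \<noteq> y"
      using w x y D(1) by auto
    then have "vdist x w = 1" "Suc (vdist w y) = vdist x y"
      using w D unfolding vdist_def x y by (auto simp del: label_dist.simps)
    then show ?thesis using w(1) by blast
  qed
qed

lemma vdist_leaf:
  assumes "v \<in> leaves \<union> inner" "label v = (j, b)" "v \<noteq> leaf i"
  shows "vdist v (leaf i) = (if j = i then b else d - b)" "vdist (leaf i) v = (if j = i then b else d - b)"
    "j = i \<Longrightarrow> b > 0" "2 * b \<le> d"
proof -
  show b: "2 * b \<le> d" using label_valid assms by blast
  show pos: "b > 0" if "j = i" using label_eq_0[of v i] assms that by (cases "b = 0") auto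
  show "vdist v (leaf i) = (if j = i then b else d - b)"
    using pos b assms d_ge_2 by (auto simp: vdist_def max_def)
  then show "vdist (leaf i) v = (if j = i then b else d - b)"
    by (simp only: vdist_sym)
qed

text \<open>A detour to the tip of a leg is strictly longer; its two parts sum to at least 2, so
  \<open>max 1\<close> makes no exception.\<close>

lemma leaf_extreme:
  assumes "x \<in> leaves \<union> inner" "y \<in> leaves \<union> inner"
    and eq: "vdist x (leaf i) + vdist (leaf i) y = vdist x y"
  shows "x = leaf i \<or> y = leaf i"
proof (rule ccontr)
  assume ne: "\<not> (x = leaf i \<or> y = leaf i)"
  obtain j a where x: "label x = (j, a)" by fastforce
  obtain l b where y: "label y = (l, b)" by fastforce
  have "vdist x y \<le> max 1 (label_dist (j, a) (l, b))"
    by (simp add: vdist_def x y)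
  then show False
    using vdist_leaf[OF assms(1) x, of i] vdist_leaf[OF assms(2) y, of i] ne eq d_ge_2
    by (cases "j = l"; cases "j = i"; cases "l = i"; auto)
qed

lemma vdist_le: "x \<in> leaves \<union> inner \<Longrightarrow> y \<in> leaves \<union> inner \<Longrightarrow> vdist x y \<le> d"
  using label_valid[of x "fst (label x)" "snd (label x)"]
    label_valid[of y "fst (label y)" "snd (label y)"] d_ge_2
  by (cases "label x"; cases "label y") (auto simp: vdist_def)

lemma diam_graph_eq: "diam graph = d"
proof (rule diam_graph[OF vdist_le])
  show "leaf 0 \<in> leaves \<union> inner" "leaf 1 \<in> leaves \<union> inner" using k_pos k_less by auto
  show "vdist (leaf 0) (leaf 1) = d" using d_ge_2 by (simp add: vdist_def)
qed

section \<open>Strong geodetic sets and cores of the blown-up spider\<close>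

lemma core_leaves: "strong_geodetic_core graph leaves (leaf ` {..<k})"
proof (rule strong_geodetic_coreI[where A = ends, OF conn_graph])
  show "leaves \<subseteq> pverts graph" "leaf ` {..<k} \<subseteq> leaves" "leaf ` {..<k} \<noteq> {}"
    using k_pos k_less by (auto simp: lessThan_empty_iff)
  fix v assume "v \<in> pverts graph - leaves"
  then have "v \<in> inner" by auto
  then obtain i j t where v: "v = enc i j t" "i < k" "i < j" "j < m" by (elim innerE)
  \<comment> \<open>The ends are set apart because leaves are encoded as
    \<open>enc i i 0\<close>.\<close>
  define q where "q t = (if t = 0 then leaf i else if t = d then leaf j else enc i j t)" for t
  have "shortest_path graph (q 0) (q d) (map q [0..<Suc d])"
    using v k_less d_ge_2
    by (intro shortest_path_map_upt) (auto simp: q_def vdist_def)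
  then have "shortest_path graph (leaf i) (leaf j) (map q [0..<Suc d])"
    using d_ge_2 by (simp add: q_def)
  moreover have "{w \<in> pverts graph - leaves. ends w = {leaf i, leaf j}} \<subseteq> set (map q [0..<Suc d])"
  proof
    fix w assume "w \<in> {w \<in> pverts graph - leaves. ends w = {leaf i, leaf j}}"
    then have "w \<in> inner" and ends: "ends w = {leaf i, leaf j}" by auto
    then obtain i' j' t' where w: "w = enc i' j' t'" "i' < j'" "0 < t'" "t' < d" by (elim innerE)
    \<comment> \<open>As \<open>i < j\<close> and \<open>i' < j'\<close>, equal ends force equal
      indices.\<close>
    then have "w = q t'"
      using ends v by (auto simp: doubleton_eq_iff q_def)
    then show "w \<in> set (map q [0..<Suc d])" using w by (auto simp del: upt_Suc)
  qed
  ultimately show "\<exists>x\<in>leaf ` {..<k}. \<exists>y\<in>leaves. \<exists>p. ends v = {x, y} \<and> shortest_path graph x y p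
      \<and> {w \<in> pverts graph - leaves. ends w = {x, y}} \<subseteq> set p"
    using v by (intro bexI[of _ "leaf i"] bexI[of _ "leaf j"] exI[of _ "map q [0..<Suc d]"]) auto
qed

lemma leaves_subset: "strong_geodetic_set graph T \<Longrightarrow> leaves \<subseteq> T"
  using extreme_in_strong_geodetic_set leaf_extreme by (auto elim!: leavesE)

lemma strong_geodetic_set_finite: "strong_geodetic_set graph T \<Longrightarrow> finite T"
  using finite_V finite_subset by (auto simp: strong_geodetic_set_def)

lemma strong_geodetic_set_leaves: "strong_geodetic_set graph leaves"
  using strong_geodetic_core_imp_set[OF core_leaves] by simp

lemma sg_graph: "sg graph = m"
  using strong_geodetic_set_leaves card_leaves
  by (rule sg_eqI)
    (use leaves_subset card_leaves strong_geodetic_set_finite in \<open>metis card_mono\<close>)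

lemma sg_set_iff: "sg_set graph T \<longleftrightarrow> T = leaves"
  using leaves_subset strong_geodetic_set_finite strong_geodetic_set_leaves card_leaves
  unfolding sg_set_def sg_graph by (metis card_subset_eq)

lemma sgc_graph: "sgc graph = k"
proof (rule sgc_eqI[OF _ core_leaves])
  show "sg_set graph leaves" by (simp add: sg_set_iff)
  show "card (leaf ` {..<k}) = k" by (simp add: card_image inj_on_def)
  fix T X assume "sg_set graph T" "strong_geodetic_core graph T X"
  then have X: "strong_geodetic_core graph leaves X" "X \<subseteq> leaves"
    by (simp_all add: sg_set_iff strong_geodetic_core_def)
  show "k \<le> card X"
  proof (rule ccontr)
    assume less: "\<not> k \<le> card X"
    let ?E = "{B. B \<subseteq> leaves \<and> card B = 2 \<and> B \<inter> X \<noteq> {}}"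
    have "{{x, y} | x y. x \<in> X \<and> y \<in> leaves \<and> 2 \<le> vdist x y} \<subseteq> ?E"
      using X(2) by (auto simp: vdist_def card_insert_if split: if_splits)
    then have "card {{x, y} | x y. x \<in> X \<and> y \<in> leaves \<and> 2 \<le> vdist x y} \<le> card ?E"
      using finite_leaves by (intro card_mono) auto
    then have "(d - 1) * card {{x, y} | x y. x \<in> X \<and> y \<in> leaves \<and> 2 \<le> vdist x y} \<le> (d - 1) * card ?E"
      by (rule mult_le_mono2)
    moreover have "card (leaves \<union> inner - leaves) = (d - 1) * (\<Sum>i<k. m - 1 - i)"
      using disjoint_leaves_inner card_inner by (simp add: Un_Diff Int_commute Diff_triv)
    ultimately have "(d - 1) * (\<Sum>i<k. m - 1 - i) \<le> (d - 1) * card ?E"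
      using card_core_le[OF X(1) Un_upper1 vdist_le] by linarith
    then have "(\<Sum>i<k. m - 1 - i) \<le> card ?E" using d_ge_2 by simp
    \<comment> \<open>Pass to complements: compare the pairs that are missed.\<close>
    then have "(m - card X choose 2) \<le> (m - k choose 2)"
      using card_pairs_meeting[OF finite_leaves X(2)] sum_lessThan_add_choose_two[of k m] k_less
        card_leaves by simp
    \<comment> \<open>With \<open>r = m - k > 0\<close>, \<open>Suc r choose 2\<close> exceeds
      \<open>r choose 2\<close> by \<open>r\<close>.\<close>
    moreover have "(Suc (m - k) choose 2) \<le> (m - card X choose 2)"
      using less k_less by (intro binomial_right_mono) auto
    ultimately show False using k_less by (simp add: numeral_2_eq_2)
  qed
qed

lemma order_graph: "order graph = m + (d - 1) * (\<Sum>i<k. m - 1 - i)"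
  using card_Un_disjoint[OF finite_leaves finite_inner disjoint_leaves_inner] card_leaves card_inner
  by simp

end

lemma spider_graph_exists:
  fixes k d s :: nat
  assumes "1 \<le> k" "2 \<le> d" "1 \<le> s"
  shows "\<exists>G :: nat pair_pre_digraph. conn_graph G \<and> sg G = k + s \<and> diam G = d \<and> sgc G = k \<and>
    int k = \<lceil>real (sg G) - (1 + sqrt ((2 * real (sg G) - 1)\<^sup>2
              - 8 * (real (order G) - real (sg G)) / (real (diam G) - 1))) / 2\<rceil>"
proof -
  interpret spider "k + s" k d using assms by unfold_locales auto
  have "real (order graph) - real (k + s) = real ((d - 1) * (\<Sum>i<k. k + s - 1 - i))"
    unfolding order_graph by (simp del: of_nat_sum)
  then show ?thesis
    using ceiling_formula[of k "k + s" d] assms sg_graph diam_graph_eq sgc_graph conn_graph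
    by (intro exI[of _ graph]) simp
qed

theorem theorem3p3:
  shows "(\<forall>k::nat. k \<ge> 2 \<longrightarrow>
            (\<exists>G :: nat pair_pre_digraph. conn_graph G \<and> sgc G = k \<and> sg G = k + 1))
       \<and> (\<forall>n::nat. n \<ge> 3 \<longrightarrow>
            (\<exists>G :: nat pair_pre_digraph. conn_graph G \<and> order G = n \<and>
               sgc G = n div 3 \<and> sg G = n - n div 3))
       \<and> (\<forall>k d s::nat. k \<ge> 1 \<and> d \<ge> 2 \<and> s \<ge> 1 \<longrightarrow>
            (\<exists>G :: nat pair_pre_digraph. conn_graph G \<and> sg G = k + s \<and> diam G = d \<and>
               sgc G = k \<and>
               int k = \<lceil>real (sg G) - (1 + sqrt ((2 * real (sg G) - 1)\<^sup>2
                          - 8 * (real (order G) - real (sg G)) / (real (diam G) - 1))) / 2\<rceil>))"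
proof (intro conjI allI impI; (elim conjE)?)
  fix k :: nat assume "k \<ge> 2"
  then show "\<exists>G :: nat pair_pre_digraph. conn_graph G \<and> sgc G = k \<and> sg G = k + 1"
    using spider_graph_exists[of k 2 1] by auto
next
  fix n :: nat assume "n \<ge> 3"
  then show "\<exists>G :: nat pair_pre_digraph. conn_graph G \<and> order G = n \<and>
      sgc G = n div 3 \<and> sg G = n - n div 3"
    by (intro complete_minus_matching) auto
qed (rule spider_graph_exists)

end
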